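(* Let $\mathbb{C}_1$ and $\mathbb{C}_2$ be process calculi such that $\mathbb{C}_1$ is not strongly replacement free and $\mathbb{C}_2$ is strongly replacement free. Then there is no basic encoding of $\mathbb{C}_1$ into $\mathbb{C}_2$.
   Context: A process calculus consists of processes built from operators, contexts, and a labelled transition semantics whose labels are actions, each either visible or the invisible action $\tau$. A $k$-hole context is a term in which $k$ sub-terms are replaced by holes $[\cdot]_1,\dots,[\cdot]_k$; $C[P_1,\dots,P_k]$ denotes the filling of the holes. $\Rightarrow$ is the reflexive-transitive closure of $\xrightarrow{\tau}$. $P\Downarrow$ ($P$ is visible) iff there exist a visible action $\alpha$ and $P'$ with $P\Rightarrow\xrightarrow{\alpha}\Rightarrow P'$; $P$ is invisible iff not $P\Downarrow$. A calculus is strongly replacement free if for every (1-hole) context $C$, every invisible process $I$ and every process $P$ of the calculus, $C[I]\Downarrow$ implies $C[P]\Downarrow$. An encoding $[\![\cdot]\!]$ (a function from processes of $\mathbb{C}_1$ to processes of $\mathbb{C}_2$) is basic if (i) it is compositional: for every $k$-ary operator $op$ of $\mathbb{C}_1$ there is a $k$-hole context $C_{op}$ of $\mathbb{C}_2$ with $[\![op(P_1,\dots,P_k)]\!]=C_{op}[[\![P_1]\!],\dots,[\![P_k]\!]]$ for all $P_1,\dots,P_k$; and (ii) it is interaction sensitive: for every process $P$ of $\mathbb{C}_1$, $P\Downarrow$ iff $[\![P]\!]\Downarrow$. *)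

theory Defs
  imports Main
begin

text \<open>
  A calculus is presented by a ranked signature of operators. Prefixes, restrictions, binders,
  process constants, etc. are operators, indexed by whatever names or other data they carry;
  processes are the ground terms over the signature. The holes of a \<open>k\<close>-hole context, written
  \<open>[_]\<^sub>1, \<dots>, [_]\<^sub>k\<close> on paper, are numbered \<open>0, \<dots>, k - 1\<close> to match list indexing.
\<close>

datatype 'op tm = Hole nat | Op 'op "'op tm list"

datatype 'a action = Tau | Vis 'a

record ('op, 'a) calculus =
  arity :: "'op \<Rightarrow> nat"
  step :: "'op tm \<Rightarrow> 'a action \<Rightarrow> 'op tm \<Rightarrow> bool"

fun wf_tm :: "('op, 'a) calculus \<Rightarrow> 'op tm \<Rightarrow> bool" where
  "wf_tm C (Hole i) \<longleftrightarrow> True"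
| "wf_tm C (Op f ts) \<longleftrightarrow> length ts = arity C f \<and> (\<forall>t\<in>set ts. wf_tm C t)"

text \<open>The hole occurrences of a term, from left to right and with repetitions.\<close>

fun holes :: "'op tm \<Rightarrow> nat list" where
  "holes (Hole i) = [i]"
| "holes (Op f ts) = concat (map holes ts)"

text \<open>
  Contexts are linear: each of the \<open>k\<close> holes replaces one sub-term, so it occurs exactly once.
  The order in which the holes occur is arbitrary.
\<close>

definition hole_context :: "('op, 'a) calculus \<Rightarrow> nat \<Rightarrow> 'op tm \<Rightarrow> bool" where
  "hole_context C k K \<longleftrightarrow> wf_tm C K \<and> distinct (holes K) \<and> set (holes K) = {..<k}"

definition process :: "('op, 'a) calculus \<Rightarrow> 'op tm \<Rightarrow> bool" where
  "process C P \<longleftrightarrow> wf_tm C P \<and> holes P = []"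

text \<open>Only meaningful for a \<open>k\<close>-hole context and a list of length \<open>k\<close>.\<close>

fun fill :: "'op tm \<Rightarrow> 'op tm list \<Rightarrow> 'op tm" where
  "fill (Hole i) Ps = Ps ! i"
| "fill (Op f ts) Ps = Op f (map (\<lambda>t. fill t Ps) ts)"

definition process_calculus :: "('op, 'a) calculus \<Rightarrow> bool" where
  "process_calculus C \<longleftrightarrow> (\<forall>P \<alpha> Q. step C P \<alpha> Q \<longrightarrow> process C P \<and> process C Q)"

definition weak :: "('op, 'a) calculus \<Rightarrow> 'op tm \<Rightarrow> 'op tm \<Rightarrow> bool" where
  "weak C = (\<lambda>P Q. step C P Tau Q)\<^sup>*\<^sup>*"

definition visible :: "('op, 'a) calculus \<Rightarrow> 'op tm \<Rightarrow> bool" where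
  "visible C P \<longleftrightarrow>
     (\<exists>a P' Q Q'. weak C P Q \<and> step C Q (Vis a) Q' \<and> weak C Q' P')"

definition strongly_replacement_free :: "('op, 'a) calculus \<Rightarrow> bool" where
  "strongly_replacement_free C \<longleftrightarrow>
     (\<forall>K I P. hole_context C 1 K \<and> process C I \<and> \<not> visible C I \<and> process C P \<longrightarrow>
        visible C (fill K [I]) \<longrightarrow> visible C (fill K [P]))"

definition encoding ::
  "('op1, 'a1) calculus \<Rightarrow> ('op2, 'a2) calculus \<Rightarrow> ('op1 tm \<Rightarrow> 'op2 tm) \<Rightarrow> bool" where
  "encoding C1 C2 enc \<longleftrightarrow> (\<forall>P. process C1 P \<longrightarrow> process C2 (enc P))"

definition compositional ::
  "('op1, 'a1) calculus \<Rightarrow> ('op2, 'a2) calculus \<Rightarrow> ('op1 tm \<Rightarrow> 'op2 tm) \<Rightarrow> bool" where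
  "compositional C1 C2 enc \<longleftrightarrow>
     (\<forall>f. \<exists>K. hole_context C2 (arity C1 f) K \<and>
        (\<forall>Ps. length Ps = arity C1 f \<and> (\<forall>P\<in>set Ps. process C1 P) \<longrightarrow>
           enc (Op f Ps) = fill K (map enc Ps)))"

definition interaction_sensitive ::
  "('op1, 'a1) calculus \<Rightarrow> ('op2, 'a2) calculus \<Rightarrow> ('op1 tm \<Rightarrow> 'op2 tm) \<Rightarrow> bool" where
  "interaction_sensitive C1 C2 enc \<longleftrightarrow>
     (\<forall>P. process C1 P \<longrightarrow> (visible C1 P \<longleftrightarrow> visible C2 (enc P)))"

definition basic_encoding ::
  "('op1, 'a1) calculus \<Rightarrow> ('op2, 'a2) calculus \<Rightarrow> ('op1 tm \<Rightarrow> 'op2 tm) \<Rightarrow> bool" where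
  "basic_encoding C1 C2 enc \<longleftrightarrow>
     encoding C1 C2 enc \<and> compositional C1 C2 enc \<and> interaction_sensitive C1 C2 enc"

end

theory Submission
  imports Defs "HOL-Library.Multiset"
begin

text \<open>
  By structural induction, a compositional encoding translates every context of the source calculus
  into a context of the target calculus with the same holes. A counterexample to strong replacement
  freeness in the source, a context \<open>K\<close> together with an invisible \<open>I\<close> and a process \<open>P\<close>, is
  therefore carried by an interaction sensitive encoding to a counterexample in the target.
\<close>

lemma wf_tm_fill:
  assumes "wf_tm C K" "\<forall>i\<in>set (holes K). i < length Qs" "\<forall>Q\<in>set Qs. wf_tm C Q"
  shows "wf_tm C (fill K Qs)"
  using assms by (induction K) auto

lemma holes_fill:
  assumes "\<forall>i\<in>set (holes K). i < length Qs"
  shows "holes (fill K Qs) = concat (map (\<lambda>i. holes (Qs ! i)) (holes K))"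
  using assms
proof (induction K)
  case (Op f ts)
  then have "map (\<lambda>t. holes (fill t Qs)) ts =
      map (\<lambda>t. concat (map (\<lambda>i. holes (Qs ! i)) (holes t))) ts"
    by (intro map_cong) auto
  then have "holes (fill (Op f ts) Qs) =
      concat (map (\<lambda>t. concat (map (\<lambda>i. holes (Qs ! i)) (holes t))) ts)"
    by (simp add: comp_def del: map_eq_conv)
  also have "\<dots> = concat (map (\<lambda>i. holes (Qs ! i)) (holes (Op f ts)))"
    by (induction ts) auto
  finally show ?case .
qed simp

text \<open>Substitution associates. The bound on the holes of \<open>K\<close> is what allows each
  lookup in \<open>map (\<lambda>Q. fill Q Ps) Qs\<close> to be moved inside the
  \<open>map\<close>.\<close>

lemma fill_fill:
  assumes "\<forall>i\<in>set (holes K). i < length Qs"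
  shows "fill (fill K Qs) Ps = fill K (map (\<lambda>Q. fill Q Ps) Qs)"
  using assms by (induction K) auto

lemma process_fill:
  assumes "wf_tm C K" "\<forall>i\<in>set (holes K). i < length Ps" "\<forall>P\<in>set Ps. process C P"
  shows "process C (fill K Ps)"
proof -
  have "holes (fill K Ps) = []"
    using assms(2,3) by (auto simp: holes_fill process_def)
  then show ?thesis
    using assms wf_tm_fill[of C K Ps] by (simp add: process_def)
qed

text \<open>
  Comparing holes as multisets makes the induction go through: the context of an operator may
  permute its arguments, but it neither drops nor duplicates them.
\<close>

lemma mset_holes_fill:
  assumes "hole_context C (length Qs) K"
  shows "mset (holes (fill K Qs)) = mset (concat (map holes Qs))"
proof -
  have K: "distinct (holes K)" "set (holes K) = {..<length Qs}"
    using assms by (auto simp: hole_context_def)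
  \<comment> \<open>By linearity, the holes of \<open>K\<close> are a permutation of all argument
    positions.\<close>
  then have "mset (holes K) = mset [0..<length Qs]"
    using set_eq_iff_mset_eq_distinct[of "holes K" "[0..<length Qs]"] by (simp add: atLeast0LessThan)
  then have "mset (map (\<lambda>i. holes (Qs ! i)) (holes K)) = mset (map (\<lambda>i. holes (Qs ! i)) [0..<length Qs])"
    by simp
  also have "map (\<lambda>i. holes (Qs ! i)) [0..<length Qs] = map holes Qs"
    by (intro nth_equalityI) auto
  finally have "mset (map (\<lambda>i. holes (Qs ! i)) (holes K)) = mset (map holes Qs)" .
  \<comment> \<open>Permuting the blocks of a concatenation only permutes its entries.\<close>
  moreover have "mset (concat xss) = mset (concat yss)" if "mset xss = mset yss"
    for xss yss :: "nat list list"
    by (simp add: mset_concat that flip: sum_mset_sum_list)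
  ultimately show ?thesis
    using K by (simp add: holes_fill)
qed

text \<open>Stated for arbitrary well-formed terms because an argument of a \<open>k\<close>-hole
  context may carry only some of the \<open>k\<close> holes. The witness \<open>K'\<close> is fixed
  before \<open>Ps\<close>, so one translation serves all fillings.\<close>

lemma compositional_term:
  assumes "compositional C1 C2 enc" and "wf_tm C1 K"
  shows "\<exists>K'. wf_tm C2 K' \<and> mset (holes K') = mset (holes K) \<and>
    (\<forall>Ps. (\<forall>i\<in>set (holes K). i < length Ps) \<and> (\<forall>P\<in>set Ps. process C1 P) \<longrightarrow>
      enc (fill K Ps) = fill K' (map enc Ps))"
  using assms(2)
proof (induction K)
  case (Hole i)
  then show ?case by (intro exI[of _ "Hole i"]) auto
next
  case (Op f ts)
  let ?ok = "\<lambda>t Ps. (\<forall>i\<in>set (holes t). i < length Ps) \<and> (\<forall>P\<in>set Ps. process C1 P)"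
  have "\<forall>t\<in>set ts. \<exists>t'. wf_tm C2 t' \<and> mset (holes t') = mset (holes t) \<and>
      (\<forall>Ps. ?ok t Ps \<longrightarrow> enc (fill t Ps) = fill t' (map enc Ps))"
    using Op by simp
  from bchoice[OF this]
  obtain g where g: "\<And>t. t \<in> set ts \<Longrightarrow> wf_tm C2 (g t) \<and> mset (holes (g t)) = mset (holes t) \<and>
      (\<forall>Ps. ?ok t Ps \<longrightarrow> enc (fill t Ps) = fill (g t) (map enc Ps))"
    by blast
  have len: "length ts = arity C1 f" and wf: "\<And>t. t \<in> set ts \<Longrightarrow> wf_tm C1 t"
    using Op.prems by auto
  obtain K where K: "hole_context C2 (length ts) K"
    and enc: "\<And>Ps. length Ps = length ts \<Longrightarrow> \<forall>P\<in>set Ps. process C1 P \<Longrightarrow>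
      enc (Op f Ps) = fill K (map enc Ps)"
    using assms(1) len unfolding compositional_def by metis
  have bound: "\<forall>i\<in>set (holes K). i < length (map g ts)" and wfK: "wf_tm C2 K"
    using K by (auto simp: hole_context_def)
  \<comment> \<open>The witness is the context \<open>K\<close> of the operator \<open>f\<close>,
    filled with the translations of its arguments.\<close>
  have "wf_tm C2 (fill K (map g ts))"
    using g wfK bound by (intro wf_tm_fill) auto
  moreover have "mset (holes (fill K (map g ts))) = mset (holes (Op f ts))"
  proof -
    have "map (mset \<circ> holes) (map g ts) = map (mset \<circ> holes) ts"
      using g by auto
    then show ?thesis
      using mset_holes_fill[of C2 "map g ts" K] K by (simp add: mset_concat comp_def del: map_eq_conv)
  qed
  moreover have "enc (fill (Op f ts) Ps) = fill (fill K (map g ts)) (map enc Ps)"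
    if ok: "?ok (Op f ts) Ps" for Ps
  proof -
    \<comment> \<open>The filled arguments are processes, so compositionality applies to
      \<open>f\<close> over them.\<close>
    have "enc (fill (Op f ts) Ps) = fill K (map enc (map (\<lambda>t. fill t Ps) ts))"
      using enc[of "map (\<lambda>t. fill t Ps) ts"] ok wf by (auto intro!: process_fill)
    also have "map enc (map (\<lambda>t. fill t Ps) ts) = map (\<lambda>Q. fill Q (map enc Ps)) (map g ts)"
      using g ok by auto
    finally show ?thesis
      using bound by (simp add: fill_fill)
  qed
  ultimately show ?case by blast
qed

lemma compositional_context:
  assumes "compositional C1 C2 enc" and "hole_context C1 k K"
  obtains K' where "hole_context C2 k K'"
    and "\<And>Ps. length Ps = k \<Longrightarrow> \<forall>P\<in>set Ps. process C1 P \<Longrightarrow> enc (fill K Ps) = fill K' (map enc Ps)"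
proof -
  have K: "wf_tm C1 K" "distinct (holes K)" "set (holes K) = {..<k}"
    using assms(2) by (auto simp: hole_context_def)
  obtain K' where K': "wf_tm C2 K'" "mset (holes K') = mset (holes K)"
    and enc: "\<And>Ps. \<forall>i\<in>set (holes K). i < length Ps \<Longrightarrow> \<forall>P\<in>set Ps. process C1 P \<Longrightarrow>
      enc (fill K Ps) = fill K' (map enc Ps)"
    using compositional_term[OF assms(1) K(1)] by blast
  \<comment> \<open>Equal multisets have the same support and multiplicities, so linearity and the
    hole set \<open>{..<k}\<close> carry over.\<close>
  have "hole_context C2 k K'"
    using K K' mset_eq_setD[OF K'(2)] mset_eq_imp_distinct_iff[OF K'(2)]
    by (simp add: hole_context_def)
  then show thesis
    using that enc K(3) by simp
qed

theorem theorem2p8: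
  fixes C1 :: "('op1, 'a1) calculus" and C2 :: "('op2, 'a2) calculus"
  assumes "process_calculus C1" and "process_calculus C2"
    and "\<not> strongly_replacement_free C1"
    and "strongly_replacement_free C2"
  shows "\<not> (\<exists>enc. basic_encoding C1 C2 enc)"
proof
  assume "\<exists>enc. basic_encoding C1 C2 enc"
  then obtain enc where enc: "encoding C1 C2 enc" and comp: "compositional C1 C2 enc"
    and sens: "interaction_sensitive C1 C2 enc"
    by (auto simp: basic_encoding_def)
  obtain K I P where K: "hole_context C1 1 K" and I: "process C1 I" "\<not> visible C1 I"
    and P: "process C1 P" and vis: "visible C1 (fill K [I])" "\<not> visible C1 (fill K [P])"
    using assms(3) by (auto simp: strongly_replacement_free_def)
  obtain K' where K': "hole_context C2 1 K'"
    and enc_fill: "\<And>Ps. length Ps = 1 \<Longrightarrow> \<forall>P\<in>set Ps. process C1 P \<Longrightarrow>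
      enc (fill K Ps) = fill K' (map enc Ps)"
    using compositional_context[OF comp K] by blast
  \<comment> \<open>Sensitivity is applied to the filled context, whose encoding is
    \<open>K'\<close> filled with \<open>enc Q\<close>.\<close>
  have "visible C1 (fill K [Q]) \<longleftrightarrow> visible C2 (fill K' [enc Q])" if "process C1 Q" for Q
  proof -
    have "process C1 (fill K [Q])"
      using K that by (intro process_fill) (auto simp: hole_context_def)
    then show ?thesis
      using sens that enc_fill[of "[Q]"] by (simp add: interaction_sensitive_def)
  qed
  moreover have "process C2 (enc I)" "process C2 (enc P)" "\<not> visible C2 (enc I)"
    using enc sens I P by (auto simp: encoding_def interaction_sensitive_def)
  \<comment> \<open>\<open>K'\<close>, \<open>enc I\<close> and \<open>enc P\<close> violate strong
    replacement freeness of \<open>C2\<close>.\<close>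
  ultimately show False
    using assms(4) K' I(1) P vis unfolding strongly_replacement_free_def by blast
qed

end
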